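(* Let $p=2$, $l\in\mathbb Z$, and $n\ge 0$ an integer. Let $u$ be the partition with $u_1=n$ and all other parts zero, and, when $n\ge 3$ is odd, let $u''$ be the partition with $u''_1=n-3$, $u''_3=1$ and all other parts zero. Let $M$ be the maximum pole of $B_n^{(l)}(x)$ and $M'$ the maximum pole of $B_n^{(l+1)}(x)$. Then: (a) $B_n^{(l-1)}(x)$ is a shifted almost maximum pole case (SAMPC) if and only if $\nu_2(\tau_u)=-M=\nu_2(B_n^{(l)}(1))$ or ($n\ge 3$ is odd and) $\nu_2(\tau_{u''})=-M=\nu_2(B_n^{(l)}(1))$, where the "or" is exclusive, and where $\nu_2(\tau_u)=-\sigma_2(n)+\nu_2\left(\binom{l-n-1}{n}\right)$ and $\nu_2(\tau_{u''})=1-\sigma_2(n)+\nu_2\left(\binom{l-n-1}{n-2}\right)$. (b) If $\nu_2(l)\le\nu_2(n)$, then $B_n^{(l)}(x)$ is an almost maximum pole case (AMPC) if and only if $B_n^{(l-1)}(x)$ is a SAMPC, and if $B_n^{(l)}(x)$ is an AMPC or $B_n^{(l-1)}(x)$ is a SAMPC, then $\nu_2(B_n^{(l)})=\nu_2(B_n^{(l)}(1))=-M$. (c) If $\nu_2(l)>\nu_2(n)$, then $\nu_2(l+1)=0$, so one can replace $l$ by $l+1$: $B_n^{(l+1)}(x)$ is an AMPC if and only if $B_n^{(l)}(x)$ is a SAMPC, and if $B_n^{(l+1)}(x)$ is an AMPC or $B_n^{(l)}(x)$ is a SAMPC, then $\nu_2(B_n^{(l+1)})=\nu_2(B_n^{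(l+1)}(1))=-M'$.
   Context: $\sigma_2(m)$ is the sum of the base $2$ digits of $m\ge 0$; $\nu_2$ is the $2$-adic valuation, with $\nu_2(0)=\infty$. For $s\in\mathbb Z$ and $d\ge 0$, $\binom sd=s(s-1)\cdots(s-d+1)/d!$. Higher order Bernoulli polynomials $B_n^{(l)}(x)$ ($n\ge 0$, $l\in\mathbb Z$) are defined by $\left(\frac{t}{e^t-1}\right)^l e^{tx}=\sum_{n\ge 0}B_n^{(l)}(x)\frac{t^n}{n!}$; $B_n^{(l)}(x)$ is monic of degree $n$ with rational coefficients, and $B_n^{(l)}=B_n^{(l)}(0)$. The maximum pole (here with respect to $p=2$) of a nonzero rational polynomial is the integer $M$ such that $-M$ is the minimum of the $2$-adic valuations of its coefficients. $B_n^{(l)}(x)$ is an almost maximum pole case (AMPC) if $\nu_2(B_n^{(l)})=-M$, where $M$ is the maximum pole of $B_n^{(l)}(x)$. $B_n^{(l)}(x)$ is a shifted almost maximum pole case (SAMPC) if $\nu_2(B_n^{(l+1)}(1))=-M'$, where $M'$ is the maximum pole of $B_n^{(l+1)}(x)$ (equivalently of $B_n^{(l+1)}(x+1)$). A partition is a sequence $v=(v_1,v_2,\dots)$ of nonnegative integers, eventually zero, with weight $w=\sum iv_i$ and $d=\sum v_i$. With $s=l-n-1$, $t_v=\binom{s}{d}\binom{d}{v_1\,v_2\,\cdots}\big/\prod_i (i+1)^{v_i}$ and $\tau_v=\frac{n!}{(n-w)!}t_v$ (for $w\le n$). *)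

theory Defs
  imports
    "HOL-Computational_Algebra.Computational_Algebra"
    "HOL-Library.Extended"
begin

definition \<sigma>\<^sub>2 :: "nat \<Rightarrow> nat" where
  "\<sigma>\<^sub>2 m = (\<Sum>i<m. (m div 2 ^ i) mod 2)"
  \<comment> \<open>digits at positions \<open>i \<ge> m\<close> vanish, since \<open>m < 2 ^ m\<close>\<close>

definition \<nu>\<^sub>2 :: "rat \<Rightarrow> int extended" where
  "\<nu>\<^sub>2 x = (if x = 0 then \<infinity> else
     (case quotient_of x of (a, b) \<Rightarrow> Fin (int (multiplicity 2 a) - int (multiplicity 2 b))))"

text \<open>
  The series \<open>(t / (e^t - 1))^l\<close> has rational coefficients; \<open>fps_bernoulli\<close> multiplies it by
  \<open>e^(t x)\<close> in the power series ring over \<open>rat poly\<close>, so that the polynomial variable plays the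
  role of \<open>x\<close>. As \<open>e^t - 1\<close> has subdegree 1, the division below is exact, and the quotient is
  a unit, which makes \<open>powi\<close> meaningful for negative exponents.
\<close>

definition fps_bernoulli :: "int \<Rightarrow> rat poly fps" where
  "fps_bernoulli l =
     Abs_fps (\<lambda>k. [: fps_nth ((fps_X / (fps_exp 1 - 1)) powi l) k :]) *
     Abs_fps (\<lambda>k. monom (1 / fact k) k)"

definition bernpoly :: "nat \<Rightarrow> int \<Rightarrow> rat poly" where
  "bernpoly n l = smult (fact n) (fps_nth (fps_bernoulli l) n)"

definition bernnum :: "nat \<Rightarrow> int \<Rightarrow> rat" where
  "bernnum n l = poly (bernpoly n l) 0"

definition max_pole :: "rat poly \<Rightarrow> int" where
  "max_pole f = (THE M. Fin (- M) = Min {\<nu>\<^sub>2 (coeff f i) | i. i \<le> degree f})"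
  \<comment> \<open>meaningful for \<open>f \<noteq> 0\<close> only, see \<open>max_pole_eq\<close>\<close>

lemma max_pole_eq:
  assumes "f \<noteq> 0"
  shows "Fin (- max_pole f) = Min {\<nu>\<^sub>2 (coeff f i) | i. i \<le> degree f}"
proof -
  define A where "A = {\<nu>\<^sub>2 (coeff f i) | i. i \<le> degree f}"
  have A: "A = (\<lambda>i. \<nu>\<^sub>2 (coeff f i)) ` {..degree f}"
    by (auto simp: A_def)
  have fin: "finite A" and ne: "A \<noteq> {}"
    by (auto simp: A)
  have "\<nu>\<^sub>2 (lead_coeff f) \<in> A"
    by (auto simp: A)
  moreover have "\<nu>\<^sub>2 (lead_coeff f) \<noteq> \<infinity>"
    using assms by (auto simp: \<nu>\<^sub>2_def split: prod.splits)
  ultimately have "Min A \<noteq> \<infinity>"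
    using Min_le[OF fin, of "\<nu>\<^sub>2 (lead_coeff f)"] by auto
  moreover have "Min A \<noteq> -\<infinity>"
    using Min_in[OF fin ne] by (auto simp: A \<nu>\<^sub>2_def split: prod.splits if_splits)
  ultimately obtain m where m: "Min A = Fin m"
    by (cases "Min A") auto
  have "Fin (- (THE M. Fin (- M) = Min A)) = Min A"
    by (rule theI[of _ "- m"]) (use m in auto)
  then show ?thesis
    by (simp add: max_pole_def A_def)
qed

definition AMPC :: "nat \<Rightarrow> int \<Rightarrow> bool" where
  "AMPC n l \<longleftrightarrow> \<nu>\<^sub>2 (bernnum n l) = Fin (- max_pole (bernpoly n l))"

definition SAMPC :: "nat \<Rightarrow> int \<Rightarrow> bool" where
  "SAMPC n l \<longleftrightarrow> \<nu>\<^sub>2 (poly (bernpoly n (l + 1)) 1) = Fin (- max_pole (bernpoly n (l + 1)))"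

text \<open>
  A partition \<open>(v\<^sub>1, v\<^sub>2, \<dots>)\<close> is a function \<open>v :: nat \<Rightarrow> nat\<close> with finite support; the entry
  \<open>v 0\<close> is not part of the partition and is ignored throughout. The sums and products range over
  the (finite) support, as all other terms are trivial.
\<close>

definition part_supp :: "(nat \<Rightarrow> nat) \<Rightarrow> nat set" where
  "part_supp v = {i. i \<ge> 1 \<and> v i \<noteq> 0}"

definition part_weight :: "(nat \<Rightarrow> nat) \<Rightarrow> nat" where
  "part_weight v = (\<Sum>i\<in>part_supp v. i * v i)"

definition part_size :: "(nat \<Rightarrow> nat) \<Rightarrow> nat" where
  "part_size v = (\<Sum>i\<in>part_supp v. v i)"

definition part_multinomial :: "(nat \<Rightarrow> nat) \<Rightarrow> rat" where
  "part_multinomial v = fact (part_size v) / (\<Prod>i\<in>part_supp v. fact (v i))"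

definition t_part :: "int \<Rightarrow> (nat \<Rightarrow> nat) \<Rightarrow> rat" where
  "t_part s v = ((of_int s :: rat) gchoose part_size v) * part_multinomial v /
     (\<Prod>i\<in>part_supp v. of_nat (i + 1) ^ v i)"

text \<open>\<open>\<tau>_part n l v\<close> is intended for \<open>part_weight v \<le> n\<close> (natural number subtraction).\<close>

definition \<tau>_part :: "nat \<Rightarrow> int \<Rightarrow> (nat \<Rightarrow> nat) \<Rightarrow> rat" where
  "\<tau>_part n l v = fact n / fact (n - part_weight v) * t_part (l - int n - 1) v"

definition part_u :: "nat \<Rightarrow> nat \<Rightarrow> nat" where
  "part_u n = (\<lambda>_. 0)(1 := n)"

definition part_u'' :: "nat \<Rightarrow> nat \<Rightarrow> nat" where
  "part_u'' n = (\<lambda>_. 0)(1 := n - 3, 3 := 1)"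

end

theory Submission
  imports Defs
begin

text \<open>
  Put \<open>s = l - n - 1\<close>. Lagrange inversion for \<open>u = e^t - 1\<close> expands \<open>B_n^(l)(x)\<close> in the basis
  \<open>(x-1)(x-2)\<cdots>(x-j)\<close> with coefficients \<open>b_(n-j)\<close>, where
  \<open>b_m = n!/(n-m)! [u^m] (ln (1 + u) / u)^s\<close>. Writing \<open>ln (1 + u) / u = 1 - u H(u) / 2\<close>, the
  series \<open>H\<close> has 2-integral coefficients as an exponential generating function, and
  \<open>H^d \<equiv> 1 + d u\<^sup>2/2!\<close> modulo 2 in this sense. Therefore
  \<open>b_m = \<Sum>_(d \<le> m) binom(n-d, m-d) w_(d,m-d) t_d\<close>, where
  \<open>t_d = n!/(n-d)! binom(s, d) (-1/2)^d\<close> belongs to the partition with \<open>d\<close> parts 1, all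
  \<open>w_(d,k)\<close> are 2-integral with \<open>w_(d,0) = 1\<close>, and \<open>w_(d,k)\<close> is even unless \<open>k = 0\<close>, or \<open>k = 2\<close>
  and \<open>d\<close> is odd. Both this system and the one passing from the \<open>b_m\<close> to the coefficients of
  the polynomial are unitriangular, so every \<open>t_d\<close> is divisible by \<open>2^(-M)\<close>. Modulo \<open>2^(1-M)\<close>
  the value \<open>B_n^(l)(1) = b_n\<close> reduces to \<open>t_n\<close>, plus \<open>t_(n-2)\<close> for odd \<open>n \<ge> 3\<close>; this is (a).
  Also \<open>B_n^(l)(0) \<equiv> b_n - b_(n-1)\<close> modulo \<open>2^(1-M)\<close>, and the recurrence for \<open>t_d\<close> shows
  \<open>b_(n-1) \<equiv> 0\<close> when \<open>\<nu>\<^sub>2(l) \<le> \<nu>\<^sub>2(n)\<close>; this is (b), and (c) is (b) for \<open>l + 1\<close>.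
\<close>

section \<open>Divisibility by powers of 2 in the 2-local rationals\<close>

text \<open>Membership in 2^k times the integers localised at 2. It expresses a valuation of at
  least \<open>k\<close> without an infinite value for \<open>x = 0\<close>.\<close>

definition pow2_dvd :: "int \<Rightarrow> rat \<Rightarrow> bool" where
  "pow2_dvd k x \<longleftrightarrow> (\<exists>a b. odd b \<and> x = 2 powi k * of_int a / of_int b)"

lemma odd_int_neq_0: "odd b \<Longrightarrow> b \<noteq> (0 :: int)"
  by auto

lemma pow2_dvdI: "odd b \<Longrightarrow> x = 2 powi k * of_int a / of_int b \<Longrightarrow> pow2_dvd k x"
  by (auto simp: pow2_dvd_def)

lemma pow2_dvd_add:
  assumes "pow2_dvd k x" "pow2_dvd k y"
  shows "pow2_dvd k (x + y)"
proof -
  obtain a b c d where *: "odd b" "x = 2 powi k * of_int a / of_int b"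
    "odd d" "y = 2 powi k * of_int c / of_int d"
    using assms by (auto simp: pow2_dvd_def)
  then have "x + y = 2 powi k * of_int (a * d + c * b) / of_int (b * d)"
    by (simp add: field_simps odd_int_neq_0)
  moreover have "odd (b * d)"
    using * by simp
  ultimately show ?thesis
    by (rule pow2_dvdI[rotated])
qed

lemma pow2_dvd_mult:
  assumes "pow2_dvd j x" "pow2_dvd k y"
  shows "pow2_dvd (j + k) (x * y)"
proof -
  obtain a b c d where *: "odd b" "x = 2 powi j * of_int a / of_int b"
    "odd d" "y = 2 powi k * of_int c / of_int d"
    using assms by (auto simp: pow2_dvd_def)
  have "x * y = 2 powi (j + k) * of_int (a * c) / of_int (b * d)"
    unfolding *(2,4) by (simp add: power_int_add)
  moreover have "odd (b * d)"
    using * by simp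
  ultimately show ?thesis
    by (rule pow2_dvdI[rotated])
qed

lemma pow2_dvd_0 [simp]: "pow2_dvd k 0"
  by (rule pow2_dvdI[of 1 _ _ 0]) auto

lemma pow2_dvd_0_of_int [simp]: "pow2_dvd 0 (of_int a)"
  by (rule pow2_dvdI[of 1 _ _ a]) auto

lemma pow2_dvd_0_of_nat [simp]: "pow2_dvd 0 (of_nat a)"
  using pow2_dvd_0_of_int[of "int a"] by simp

lemma pow2_dvd_0_1 [simp]: "pow2_dvd 0 1"
  using pow2_dvd_0_of_int[of 1] by simp

lemma pow2_dvd_1_of_int_iff [simp]: "pow2_dvd 1 (of_int a) \<longleftrightarrow> even a"
proof
  assume "pow2_dvd 1 (of_int a)"
  then obtain c b where *: "odd b" "of_int a = 2 * (of_int c :: rat) / of_int b"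
    by (auto simp: pow2_dvd_def)
  then have "(of_int (a * b) :: rat) = of_int (2 * c)"
    by (simp add: field_simps odd_int_neq_0)
  then have "a * b = 2 * c"
    by (simp only: of_int_eq_iff)
  then have "even (a * b)"
    by simp
  with * show "even a"
    by simp
next
  assume "even a"
  then obtain c where "a = 2 * c" ..
  then show "pow2_dvd 1 (of_int a)"
    by (intro pow2_dvdI[of 1 _ _ c]) auto
qed

lemma pow2_dvd_minus_iff [simp]: "pow2_dvd k (- x) \<longleftrightarrow> pow2_dvd k x"
proof -
  have *: "pow2_dvd k (- y)" if "pow2_dvd k y" for y
    using pow2_dvd_mult[OF that pow2_dvd_0_of_int[of "-1"]] by simp
  show ?thesis
    using *[of x] *[of "- x"] by auto
qed

lemma pow2_dvd_diff: "pow2_dvd k x \<Longrightarrow> pow2_dvd k y \<Longrightarrow> pow2_dvd k (x - y)"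
  using pow2_dvd_add[of k x "- y"] by simp

lemma pow2_dvd_sum: "(\<And>i. i \<in> A \<Longrightarrow> pow2_dvd k (f i)) \<Longrightarrow> pow2_dvd k (sum f A)"
  by (induction A rule: infinite_finite_induct) (auto intro: pow2_dvd_add)

lemma pow2_dvd_mult_left: "pow2_dvd 0 x \<Longrightarrow> pow2_dvd k y \<Longrightarrow> pow2_dvd k (x * y)"
  using pow2_dvd_mult[of 0 x k y] by simp

lemma pow2_dvd_powi_mult_iff: "pow2_dvd (j + k) (2 powi j * x) \<longleftrightarrow> pow2_dvd k x"
  unfolding pow2_dvd_def by (simp add: power_int_add flip: times_divide_eq_right)

lemma pow2_dvd_antimono:
  assumes "pow2_dvd k x" "j \<le> k"
  shows "pow2_dvd j x"
proof -
  obtain a b where *: "odd b" "x = 2 powi k * of_int a / of_int b"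
    using assms by (auto simp: pow2_dvd_def)
  have "(2 :: rat) powi k = 2 powi j * 2 ^ nat (k - j)"
    using assms(2) power_int_add[of "2 :: rat" j "k - j"] by (simp add: power_int_def)
  with * have "x = 2 powi j * of_int (2 ^ nat (k - j) * a) / of_int b"
    by simp
  with * show ?thesis
    by (intro pow2_dvdI)
qed

lemma pow2_dvd_odd_mult_cancel:
  assumes "pow2_dvd k (of_int c * x)" "odd c"
  shows "pow2_dvd k x"
proof -
  obtain a b where *: "odd b" "of_int c * x = 2 powi k * of_int a / of_int b"
    using assms by (auto simp: pow2_dvd_def)
  then have "x = 2 powi k * of_int a / of_int (b * c)"
    using assms(2) by (simp add: field_simps odd_int_neq_0)
  with * assms(2) show ?thesis
    by (intro pow2_dvdI[of "b * c"]) auto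
qed

section \<open>The valuation in terms of divisibility\<close>

lemma rat_pow2_decomp:
  assumes "(x :: rat) \<noteq> 0"
  obtains k a b where "odd a" "odd b" "x = 2 powi k * of_int a / of_int b" "\<nu>\<^sub>2 x = Fin k"
proof -
  obtain p q where pq: "quotient_of x = (p, q)"
    by (cases "quotient_of x")
  then have x: "x = of_int p / of_int q" and "q \<noteq> 0"
    using quotient_of_div[OF pq] quotient_of_denom_pos[OF pq] by auto
  with assms have "p \<noteq> 0" by auto
  obtain a where a: "p = 2 ^ multiplicity 2 p * a" "odd a"
    using multiplicity_decompose'[of p 2] \<open>p \<noteq> 0\<close> by auto
  obtain b where b: "q = 2 ^ multiplicity 2 q * b" "odd b"
    using multiplicity_decompose'[of q 2] \<open>q \<noteq> 0\<close> by auto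
  define k where "k = int (multiplicity 2 p) - int (multiplicity 2 q)"
  have "x = (2 ^ multiplicity 2 p * of_int a) / (2 ^ multiplicity 2 q * of_int b)"
    unfolding x by (subst a(1), subst b(1)) simp
  also have "\<dots> = 2 powi k * of_int a / of_int b"
    by (simp add: k_def power_int_diff)
  finally have "x = 2 powi k * of_int a / of_int b" .
  moreover have "\<nu>\<^sub>2 x = Fin k"
    using assms pq by (simp add: \<nu>\<^sub>2_def k_def)
  ultimately show thesis
    using that a b by blast
qed

lemma le_\<nu>\<^sub>2_iff: "Fin k \<le> \<nu>\<^sub>2 x \<longleftrightarrow> pow2_dvd k x"
proof (cases "x = 0")
  case True
  then show ?thesis by (simp add: \<nu>\<^sub>2_def)
next
  case False
  then obtain m a b where *: "odd a" "odd b" "x = 2 powi m * of_int a / of_int b" "\<nu>\<^sub>2 x = Fin m"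
    by (rule rat_pow2_decomp)
  have m: "pow2_dvd m x"
    using * by (intro pow2_dvdI)
  have "\<not> pow2_dvd (m + 1) x"
  proof
    \<comment> \<open>Dividing by \<open>2 powi m\<close> and clearing the odd \<open>b\<close>
      would make the odd integer \<open>a\<close> divisible by 2.\<close>
    assume "pow2_dvd (m + 1) x"
    moreover have "of_int a = of_int b * (2 powi (- m) * x)"
      using *(2) unfolding *(3) by (simp add: power_int_minus odd_int_neq_0)
    moreover have "pow2_dvd 1 (2 powi (- m) * x) \<longleftrightarrow> pow2_dvd (m + 1) x"
      using pow2_dvd_powi_mult_iff[of "- m" "m + 1" x] by simp
    ultimately have "pow2_dvd 1 (of_int a)"
      by (simp only: pow2_dvd_mult_left pow2_dvd_0_of_int)
    with * show False by simp
  qed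
  then have "pow2_dvd k x \<longleftrightarrow> k \<le> m"
    using m pow2_dvd_antimono[of m x k] pow2_dvd_antimono[of k x "m + 1"]
    by (cases "k \<le> m") auto
  with * show ?thesis by simp
qed

lemma \<nu>\<^sub>2_neq_Minf: "\<nu>\<^sub>2 x \<noteq> -\<infinity>"
  by (auto simp: \<nu>\<^sub>2_def split: prod.splits)

lemma \<nu>\<^sub>2_eq_Fin_iff: "\<nu>\<^sub>2 x = Fin k \<longleftrightarrow> pow2_dvd k x \<and> \<not> pow2_dvd (k + 1) x"
  unfolding le_\<nu>\<^sub>2_iff[symmetric] by (cases "\<nu>\<^sub>2 x") (auto simp: \<nu>\<^sub>2_neq_Minf)

text \<open>Finite lower bounds tell all values above -\<infinity> apart, \<infinity> being the only
  one that satisfies all of them.\<close>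

lemma extended_int_eqI:
  fixes x y :: "int extended"
  assumes "\<And>k. Fin k \<le> x \<longleftrightarrow> Fin k \<le> y" "x \<noteq> -\<infinity>" "y \<noteq> -\<infinity>"
  shows "x = y"
proof (cases x)
  case x: (Fin a)
  show ?thesis
  proof (cases y)
    case (Fin b)
    then show ?thesis
      using assms(1)[of a] assms(1)[of b] x by simp
  next
    case Pinf
    then show ?thesis
      using assms(1)[of "a + 1"] x by simp
  qed (use assms in auto)
next
  case x: Pinf
  show ?thesis
  proof (cases y)
    case (Fin b)
    then show ?thesis
      using assms(1)[of "b + 1"] x by simp
  qed (use assms x in auto)
qed (use assms in auto)

lemma \<nu>\<^sub>2_eqI: "(\<And>k. pow2_dvd k x \<longleftrightarrow> pow2_dvd k y) \<Longrightarrow> \<nu>\<^sub>2 x = \<nu>\<^sub>2 y"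
  by (rule extended_int_eqI) (simp_all add: le_\<nu>\<^sub>2_iff \<nu>\<^sub>2_neq_Minf)

lemma \<nu>\<^sub>2_odd_mult: "odd c \<Longrightarrow> \<nu>\<^sub>2 (of_int c * x) = \<nu>\<^sub>2 x"
  by (rule \<nu>\<^sub>2_eqI) (auto intro: pow2_dvd_mult_left dest: pow2_dvd_odd_mult_cancel)

lemma \<nu>\<^sub>2_minus_one_power_mult: "\<nu>\<^sub>2 ((-1) ^ n * x) = \<nu>\<^sub>2 x"
  using \<nu>\<^sub>2_odd_mult[of "(-1) ^ n" x] by simp

lemma \<nu>\<^sub>2_powi_mult: "\<nu>\<^sub>2 (2 powi k * x) = Fin k + \<nu>\<^sub>2 x"
proof (rule extended_int_eqI)
  fix j
  have "Fin j \<le> \<nu>\<^sub>2 (2 powi k * x) \<longleftrightarrow> Fin (j - k) \<le> \<nu>\<^sub>2 x"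
    using pow2_dvd_powi_mult_iff[of k "j - k" x] by (simp add: le_\<nu>\<^sub>2_iff)
  also have "\<dots> \<longleftrightarrow> Fin j \<le> Fin k + \<nu>\<^sub>2 x"
    by (cases "\<nu>\<^sub>2 x") auto
  finally show "Fin j \<le> \<nu>\<^sub>2 (2 powi k * x) \<longleftrightarrow> Fin j \<le> Fin k + \<nu>\<^sub>2 x" .
  show "Fin k + \<nu>\<^sub>2 x \<noteq> -\<infinity>"
    using \<nu>\<^sub>2_neq_Minf[of x] by (cases "\<nu>\<^sub>2 x") auto
qed (rule \<nu>\<^sub>2_neq_Minf)

text \<open>The residue field at 2 has a single nonzero class, so two elements of exact valuation
  \<open>k\<close> cancel to the next order.\<close>

lemma pow2_dvd_Suc_add:
  assumes "pow2_dvd k x" "\<not> pow2_dvd (k + 1) x" "pow2_dvd k y" "\<not> pow2_dvd (k + 1) y"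
  shows "pow2_dvd (k + 1) (x + y)"
proof -
  obtain a b c d where *: "odd b" "x = 2 powi k * of_int a / of_int b"
    "odd d" "y = 2 powi k * of_int c / of_int d"
    using assms by (auto simp: pow2_dvd_def)
  have even: "pow2_dvd (k + 1) (2 powi k * of_int m / of_int n)" if "even m" "odd n" for m n
  proof -
    from that obtain h where "m = 2 * h" by blast
    with that show ?thesis
      by (intro pow2_dvdI[of n _ _ h]) (auto simp: power_int_add)
  qed
  have "odd a" "odd c"
    using even[of a b] even[of c d] * assms by auto
  moreover have "x + y = 2 powi k * of_int (a * d + c * b) / of_int (b * d)"
    unfolding *(2,4) using *(1,3)
    by (subst add_frac_eq) (simp_all add: algebra_simps odd_int_neq_0)
  ultimately show ?thesis
    using * even[of "a * d + c * b" "b * d"] by simp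
qed

lemma pow2_dvd_cong: "pow2_dvd k (x - y) \<Longrightarrow> pow2_dvd k x \<longleftrightarrow> pow2_dvd k y"
  using pow2_dvd_add[of k "x - y" y] pow2_dvd_diff[of k x "x - y"] by auto

text \<open>Addition in the field with two elements; this is the source of the exclusive "or" in
  (a).\<close>

lemma pow2_dvd_Suc_add_iff:
  assumes "pow2_dvd k x" "pow2_dvd k y"
  shows "pow2_dvd (k + 1) (x + y) \<longleftrightarrow> (pow2_dvd (k + 1) x \<longleftrightarrow> pow2_dvd (k + 1) y)"
proof (cases "pow2_dvd (k + 1) x")
  case True
  then show ?thesis
    using pow2_dvd_cong[of "k + 1" "x + y" y] by simp
next
  case False
  show ?thesis
  proof (cases "pow2_dvd (k + 1) y")
    case True
    then show ?thesis
      using pow2_dvd_cong[of "k + 1" "x + y" x] by simp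
  next
    case False
    with \<open>\<not> pow2_dvd (k + 1) x\<close> show ?thesis
      using pow2_dvd_Suc_add[of k x y] assms by simp
  qed
qed

lemma pow2_dvd_double: "pow2_dvd k x \<Longrightarrow> pow2_dvd (k + 1) (2 * x)"
  using pow2_dvd_powi_mult_iff[of 1 k x] by (simp add: add.commute)

lemma pow2_dvd_even_mult: "pow2_dvd k x \<Longrightarrow> even c \<Longrightarrow> pow2_dvd (k + 1) (of_int c * x)"
  using pow2_dvd_mult[of 1 "of_int c" k x] by (simp add: add.commute)

section \<open>The generating functions\<close>

text \<open>As \<open>b ^ i\<close> has no terms below degree \<open>i\<close>, the inner sum may
  run up to \<open>m\<close> for every \<open>j\<close>, and the two sums can be swapped.\<close>

lemma fps_compose_mult_nth:
  fixes a b c :: "'a::idom fps"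
  assumes "b $ 0 = 0"
  shows "((a oo b) * c) $ m = (\<Sum>i\<le>m. a $ i * (b ^ i * c) $ m)"
proof -
  have "((a oo b) * c) $ m = (\<Sum>j=0..m. (\<Sum>i=0..j. a $ i * b ^ i $ j) * c $ (m - j))"
    by (simp add: fps_mult_nth fps_compose_nth)
  also have "\<dots> = (\<Sum>j=0..m. (\<Sum>i=0..m. a $ i * b ^ i $ j) * c $ (m - j))"
    using assms
    by (intro sum.cong refl arg_cong2[where f = "(*)"] sum.mono_neutral_left)
      (auto simp: startsby_zero_power_prefix)
  also have "\<dots> = (\<Sum>j=0..m. \<Sum>i=0..m. a $ i * (b ^ i $ j * c $ (m - j)))"
    by (simp add: sum_distrib_right mult.assoc)
  also have "\<dots> = (\<Sum>i=0..m. \<Sum>j=0..m. a $ i * (b ^ i $ j * c $ (m - j)))"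
    by (rule sum.swap)
  finally show ?thesis
    by (simp add: fps_mult_nth sum_distrib_left atMost_atLeast0)
qed

text \<open>Treats exponents of both signs at once, so that the exponent law and the expansion in
  powers of \<open>a - 1\<close> come from the binomial series.\<close>

lemma fps_powi_conv_binomial:
  fixes a :: "'a::field_char_0 fps"
  assumes "a $ 0 = 1"
  shows "a powi s = fps_binomial (of_int s) oo (a - 1)"
proof -
  have *: "(1 + fps_X) ^ n oo (a - 1) = a ^ n" for n
    using assms by (simp flip: fps_compose_power add: fps_compose_add_distrib)
  show ?thesis
  proof (cases "s \<ge> 0")
    case True
    then obtain n where "s = int n"
      using nonneg_eq_int by blast
    with *[of n] show ?thesis
      by (simp add: fps_binomial_of_nat)
  next
    case False
    then obtain n where "s = - int n" "n > 0"
      by (metis neg_0_less_iff_less not_le zero_less_imp_eq_int minus_minus)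
    with *[of n] assms show ?thesis
      by (simp add: power_int_def fps_binomial_minus_of_nat fps_inverse_compose flip: fps_inverse_power)
  qed
qed

lemma fps_powi_add:
  fixes a :: "'a::field_char_0 fps"
  assumes "a $ 0 = 1"
  shows "a powi (r + s) = a powi r * a powi s"
  using assms
  by (simp add: fps_powi_conv_binomial fps_binomial_add_mult fps_compose_mult_distrib)

section \<open>The Todd series and its powers\<close>

definition todd_fps :: "rat fps" where
  "todd_fps = fps_X / (fps_exp 1 - 1)"

lemma todd_fps_times: "todd_fps * (fps_exp 1 - 1) = fps_X"
proof -
  have "(fps_exp 1 - 1 :: rat fps) $ 1 = 1"
    by simp
  then have "subdegree (fps_exp 1 - 1 :: rat fps) \<le> 1" "(fps_exp 1 - 1 :: rat fps) \<noteq> 0"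
    by (metis subdegree_leI one_neq_zero, metis fps_zero_nth one_neq_zero)
  then show ?thesis
    unfolding todd_fps_def by (intro fps_times_divide_eq) auto
qed

lemma todd_fps_nth_0: "todd_fps $ 0 = 1"
proof -
  have "(todd_fps * (fps_exp 1 - 1)) $ 1 = todd_fps $ 0"
    by (simp add: fps_mult_nth)
  then show ?thesis
    by (simp add: todd_fps_times)
qed

text \<open>Differentiate f (e^t - 1) = t, multiply by f, and replace f (e^t - 1) by t once
  more.\<close>

lemma todd_fps_ODE: "fps_X * fps_deriv todd_fps = todd_fps - todd_fps\<^sup>2 * fps_exp 1"
proof -
  have "fps_deriv todd_fps * (fps_exp 1 - 1) + todd_fps * fps_exp 1 = 1"
    using arg_cong[OF todd_fps_times, of fps_deriv] by (simp add: algebra_simps)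
  then have "todd_fps * (fps_deriv todd_fps * (fps_exp 1 - 1) + todd_fps * fps_exp 1) = todd_fps"
    by simp
  then show ?thesis
    unfolding todd_fps_times[symmetric] by (simp add: algebra_simps power2_eq_square)
qed

text \<open>Formally the residue of du / u^(m+1) for u = e^t - 1, the core of Lagrange inversion.
  For m > 0, t d/dt multiplies the coefficient of t^m in f^m by m; comparison with the differential
  equation forces that of f^(m+1) e^t to vanish.\<close>

lemma todd_fps_power_Suc_exp_nth: "(todd_fps ^ Suc m * fps_exp 1) $ m = (if m = 0 then 1 else 0)"
proof (cases m)
  case 0
  then show ?thesis
    by (simp add: todd_fps_nth_0)
next
  case (Suc k)
  let ?f = todd_fps
  have "fps_X * fps_deriv (?f ^ m) = of_nat m * ?f ^ k * (fps_X * fps_deriv ?f)"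
    by (simp only: fps_deriv_power' Suc diff_Suc_1 mult_ac)
  also have "\<dots> = of_nat m * (?f ^ m - ?f ^ Suc m * fps_exp 1)"
    unfolding todd_fps_ODE Suc
    by (simp only: right_diff_distrib power_Suc power2_eq_square mult_ac)
  finally have "fps_X * fps_deriv (?f ^ m) = fps_const (of_nat m) * (?f ^ m - ?f ^ Suc m * fps_exp 1)"
    by (simp only: fps_of_nat)
  from arg_cong[OF this, of "\<lambda>g. g $ m"]
  have "of_nat m * ?f ^ m $ m = of_nat m * (?f ^ m $ m - (?f ^ Suc m * fps_exp 1) $ m)"
    by (simp only: fps_mult_left_const_nth fps_sub_nth) (simp add: Suc del: power_Suc of_nat_Suc)
  then show ?thesis
    by (simp add: Suc del: power_Suc of_nat_Suc)
qed

text \<open>The series \<open>-2 (ln (1 + X) / X - 1) / X\<close>; the scaling makes it 2-integral in the sense of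
  \<open>hurwitz\<close> below.\<close>

definition log_fps :: "rat fps" where
  "log_fps = Abs_fps (\<lambda>k. (-1) ^ k * 2 / of_nat (k + 2))"

text \<open>With u = e^t - 1 one has t = ln (1 + u), so the Todd series t / u is ln (1 + u) / u as a
  series in u.\<close>

lemma todd_fps_conv_log_fps:
  "todd_fps - 1 = (fps_const (- 1 / 2) * (fps_X * log_fps)) oo (fps_exp 1 - 1)"
proof -
  define K where "K = fps_const (- 1 / 2) * (fps_X * log_fps)"
  let ?e = "fps_exp 1 - 1 :: rat fps"
  have "fps_X * (1 + K) = fps_ln 1"
  proof (rule fps_ext)
    fix n
    show "(fps_X * (1 + K)) $ n = fps_ln 1 $ n"
    proof (cases "n \<ge> 2")
      case True
      then obtain k where "n = Suc (Suc k)"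
        by (metis Suc_le_D numeral_2_eq_2 Suc_le_mono)
      then show ?thesis
        by (simp add: K_def fps_ln_nth log_fps_def)
    next
      case False
      then have "n = 0 \<or> n = 1"
        by auto
      then show ?thesis
        by (auto simp: K_def fps_ln_nth)
    qed
  qed
  then have "fps_X * (1 + K) oo ?e = fps_X"
    by (simp add: fps_ln_fps_exp_inv fps_inv)
  then have "?e * (1 + (K oo ?e)) = ?e * todd_fps"
    using todd_fps_times by (simp add: fps_compose_mult_distrib fps_compose_add_distrib mult.commute)
  moreover have "?e $ 1 \<noteq> 0"
    by simp
  then have "?e \<noteq> 0"
    by (metis fps_zero_nth)
  ultimately have "1 + (K oo ?e) = todd_fps"
    by simp
  then show ?thesis
    unfolding K_def[symmetric] by (simp add: eq_diff_eq add.commute flip: \<open>1 + (K oo ?e) = todd_fps\<close>)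
qed

text \<open>Lagrange inversion for \<open>u = e^t - 1\<close>: this is the coefficient of \<open>u^m\<close> in
  \<open>(ln (1 + u) / u)^s\<close>.\<close>

lemma todd_fps_powi_exp_nth:
  "(todd_fps powi (s + int m + 1) * fps_exp 1) $ m =
    (\<Sum>d\<le>m. (of_int s gchoose d) * (- 1 / 2) ^ d * (log_fps ^ d) $ (m - d))"
proof -
  define K where "K = fps_const (- 1 / 2) * (fps_X * log_fps)"
  define G where "G = fps_binomial (of_int s) oo K"
  let ?e = "fps_exp 1 - 1 :: rat fps"
  have K0: "K $ 0 = 0"
    by (simp add: K_def)
  have "todd_fps powi s = fps_binomial (of_int s) oo (K oo ?e)"
    by (simp add: fps_powi_conv_binomial todd_fps_nth_0 todd_fps_conv_log_fps K_def)
  also have "\<dots> = G oo ?e"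
    unfolding G_def by (rule fps_compose_assoc) (simp_all add: K0)
  finally have *: "todd_fps powi (s + int m + 1) = (G oo ?e) * todd_fps ^ Suc m"
    using fps_powi_add[OF todd_fps_nth_0, of s "int (Suc m)"] power_int_of_nat[of todd_fps "Suc m"]
    by (simp add: add_ac del: power_Suc power_int_of_nat)
  \<comment> \<open>\<open>?e ^ i\<close> cancels \<open>i\<close> of the \<open>m + 1\<close> Todd
    factors and leaves t^i, so the residue is taken at index \<open>m - i\<close>.\<close>
  have nth: "(?e ^ i * (todd_fps ^ Suc m * fps_exp 1)) $ m = (if i = m then 1 else 0)" if "i \<le> m" for i
  proof -
    have "todd_fps ^ Suc m = todd_fps ^ i * todd_fps ^ Suc (m - i)"
      using that by (simp flip: power_add)
    then have "?e ^ i * (todd_fps ^ Suc m * fps_exp 1) =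
        (todd_fps * ?e) ^ i * (todd_fps ^ Suc (m - i) * fps_exp 1)"
      by (simp only: power_mult_distrib mult_ac)
    also have "\<dots> $ m = (if i = m then 1 else 0)"
      unfolding todd_fps_times using that
      by (simp add: fps_X_power_mult_nth todd_fps_power_Suc_exp_nth del: power_Suc)
    finally show ?thesis .
  qed
  have "(todd_fps powi (s + int m + 1) * fps_exp 1) $ m =
      ((G oo ?e) * (todd_fps ^ Suc m * fps_exp 1)) $ m"
    by (simp only: * mult.assoc)
  also have "\<dots> = (\<Sum>i\<le>m. G $ i * (?e ^ i * (todd_fps ^ Suc m * fps_exp 1)) $ m)"
    by (rule fps_compose_mult_nth) simp
  also have "\<dots> = (\<Sum>i\<le>m. if i = m then G $ i else 0)"
    by (intro sum.cong) (auto simp: nth simp del: power_Suc)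
  also have "\<dots> = G $ m"
    by simp
  also have "\<dots> = (\<Sum>d\<le>m. (of_int s gchoose d) * (K ^ d) $ m)"
    by (simp add: G_def fps_compose_nth atMost_atLeast0)
  also have "\<dots> = (\<Sum>d\<le>m. (of_int s gchoose d) * (- 1 / 2) ^ d * (log_fps ^ d) $ (m - d))"
  proof (intro sum.cong refl)
    fix d assume "d \<in> {..m}"
    have "K ^ d = fps_const ((- 1 / 2) ^ d) * (fps_X ^ d * log_fps ^ d)"
      by (simp only: K_def power_mult_distrib fps_const_power)
    with \<open>d \<in> {..m}\<close> show "(of_int s gchoose d) * (K ^ d) $ m =
        (of_int s gchoose d) * (- 1 / 2) ^ d * (log_fps ^ d) $ (m - d)"
      by (simp only: fps_mult_left_const_nth fps_X_power_mult_nth) simp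
  qed
  finally show ?thesis .
qed

section \<open>Powers of the logarithmic series modulo 2\<close>

text \<open>Hurwitz series: the divisibility concerns the coefficients of the exponential generating
  function. Products behave well because these coefficients convolve with integral binomial
  weights.\<close>

definition hurwitz :: "int \<Rightarrow> rat fps \<Rightarrow> bool" where
  "hurwitz j a \<longleftrightarrow> (\<forall>k. pow2_dvd j (fact k * a $ k))"

lemma hurwitzD: "hurwitz j a \<Longrightarrow> pow2_dvd j (fact k * a $ k)"
  by (simp add: hurwitz_def)

lemma hurwitz_antimono: "hurwitz j a \<Longrightarrow> i \<le> j \<Longrightarrow> hurwitz i a"
  by (metis hurwitz_def pow2_dvd_antimono)

lemma hurwitz_add: "hurwitz j a \<Longrightarrow> hurwitz j b \<Longrightarrow> hurwitz j (a + b)"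
  by (auto simp: hurwitz_def ring_distribs intro: pow2_dvd_add)

lemma hurwitz_mult:
  assumes "hurwitz i a" "hurwitz j b"
  shows "hurwitz (i + j) (a * b)"
  unfolding hurwitz_def
proof
  fix k
  have "fact k * (a * b) $ k =
      (\<Sum>r=0..k. of_nat (k choose r) * ((fact r * a $ r) * (fact (k - r) * b $ (k - r))))"
    unfolding fps_mult_nth sum_distrib_left
    by (intro sum.cong refl) (simp add: binomial_fact field_simps)
  also have "pow2_dvd (i + j) \<dots>"
    by (rule pow2_dvd_sum, rule pow2_dvd_mult_left[OF pow2_dvd_0_of_nat], rule pow2_dvd_mult)
      (rule hurwitzD[OF assms(1)], rule hurwitzD[OF assms(2)])
  finally show "pow2_dvd (i + j) (fact k * (a * b) $ k)" .
qed

text \<open>For odd \<open>k\<close> the denominator is a unit; for \<open>k = 2 * r\<close> the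
  distinct factors 2 and \<open>r + 1\<close> of k! multiply to k + 2. At \<open>k = 0\<close> and
  \<open>k = 2\<close> the quotient is 1/2, whence the two terms of the comparison series
  below.\<close>

lemma dvd_fact_div_2:
  assumes "k \<ge> 3"
  shows "pow2_dvd 0 (fact k / of_nat (k + 2))"
proof (cases "even k")
  case False
  then show ?thesis
    by (intro pow2_dvdI[of "int (k + 2)" _ _ "fact k"]) auto
next
  case True
  then obtain r where r: "k = 2 * r" ..
  with assms have "r \<ge> 2"
    by auto
  have "{2, r + 1} \<subseteq> {1..k}" "2 \<noteq> r + 1"
    using r \<open>r \<ge> 2\<close> by auto
  then have "\<Prod>{2, r + 1} dvd \<Prod>{1..k}"
    by (intro prod_dvd_prod_subset) auto
  with \<open>2 \<noteq> r + 1\<close> have "k + 2 dvd fact k"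
    by (simp add: r fact_prod algebra_simps)
  then obtain q where "fact k = (k + 2) * q" ..
  then have "(fact k :: rat) = of_nat (k + 2) * of_nat q"
    by (metis of_nat_fact of_nat_mult)
  moreover have "(of_nat (k + 2) :: rat) \<noteq> 0"
    unfolding of_nat_eq_0_iff by simp
  ultimately show ?thesis
    by simp
qed

lemma hurwitz_quad: "hurwitz 0 (1 + fps_const (of_nat d / 2) * fps_X ^ 2)"
proof -
  have "fact k * (1 + fps_const (of_nat d / 2) * fps_X ^ 2 :: rat fps) $ k =
      of_nat (if k = 0 then 1 else if k = 2 then d else 0)" for k
    by (simp add: fps_X_power_nth fact_numeral)
  then show ?thesis
    unfolding hurwitz_def by (simp only: pow2_dvd_0_of_nat) simp
qed

lemma hurwitz_log_fps: "hurwitz 1 (log_fps - (1 + fps_const (1 / 2) * fps_X ^ 2))"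
  unfolding hurwitz_def
proof
  fix k :: nat
  consider "k = 0" | "k = 1" | "k = 2" | "k \<ge> 3"
    by linarith
  then show "pow2_dvd 1 (fact k * (log_fps - (1 + fps_const (1 / 2) * fps_X ^ 2)) $ k)"
  proof cases
    case 2
    then show ?thesis
      \<comment> \<open>The coefficient at \<open>k = 1\<close> is -2/3.\<close>
      by (intro pow2_dvdI[of 3 _ _ "-1"]) (simp_all add: log_fps_def fps_X_power_nth)
  next
    case 4
    then have "fact k * (log_fps - (1 + fps_const (1 / 2) * fps_X ^ 2)) $ k =
        2 powi 1 * (of_int ((-1) ^ k) * (fact k / of_nat (k + 2)))"
      by (simp add: log_fps_def fps_X_power_nth)
    moreover have "pow2_dvd (1 + 0) (2 powi 1 * (of_int ((-1) ^ k) * (fact k / of_nat (k + 2))))"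
      unfolding pow2_dvd_powi_mult_iff
      by (rule pow2_dvd_mult_left[OF pow2_dvd_0_of_int dvd_fact_div_2[OF 4]])
    ultimately show ?thesis
      by simp
  qed (simp_all add: log_fps_def fps_X_power_nth)
qed

text \<open>Multiplying the comparison polynomials for \<open>d\<close> and 1 creates the extra term
  d X^4 / 4, which is harmless since 4! d / 4 = 6 d is even.\<close>

lemma hurwitz_log_fps_power:
  "hurwitz 1 (log_fps ^ d - (1 + fps_const (of_nat d / 2) * fps_X ^ 2))"
proof (induction d)
  case 0
  then show ?case
    by (simp add: hurwitz_def)
next
  case (Suc d)
  let ?Q = "\<lambda>d. 1 + fps_const (of_nat d / 2) * fps_X ^ 2 :: rat fps"
  have L: "hurwitz 1 (log_fps - ?Q 1)"
    using hurwitz_log_fps by simp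
  have Q: "?Q d * ?Q 1 = ?Q (Suc d) + fps_const (of_nat d / 4) * fps_X ^ 4"
  proof -
    have "(1 + a * y) * (1 + b * y) = 1 + (a + b) * y + (a * b) * y\<^sup>2" for a b y :: "rat fps"
      by (simp add: algebra_simps power2_eq_square)
    from this[of "fps_const (of_nat d / 2)" "fps_X\<^sup>2" "fps_const (1 / 2)"] show ?thesis
      by (simp add: add_divide_distrib add.commute flip: power_mult)
  qed
  have "hurwitz 1 (fps_const (of_nat d / 4) * fps_X ^ 4)"
  proof -
    have "fact k * (fps_const (of_nat d / 4) * fps_X ^ 4 :: rat fps) $ k =
        of_int (if k = 4 then 6 * int d else 0)" for k
      by (simp add: fps_X_power_nth fact_numeral)
    then show ?thesis
      unfolding hurwitz_def by (simp only: pow2_dvd_1_of_int_iff) simp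
  qed
  moreover have "hurwitz 0 log_fps"
  proof -
    have "hurwitz 0 (log_fps - ?Q 1)"
      by (rule hurwitz_antimono[OF L]) simp
    from hurwitz_add[OF this hurwitz_quad[of 1]] show ?thesis
      by simp
  qed
  then have "hurwitz (1 + 0) ((log_fps ^ d - ?Q d) * log_fps)"
    by (intro hurwitz_mult Suc)
  moreover have "hurwitz (0 + 1) (?Q d * (log_fps - ?Q 1))"
    by (intro hurwitz_mult L hurwitz_quad)
  ultimately have "hurwitz 1 ((log_fps ^ d - ?Q d) * log_fps + ?Q d * (log_fps - ?Q 1)
      + fps_const (of_nat d / 4) * fps_X ^ 4)"
    by (intro hurwitz_add) simp_all
  also have "(log_fps ^ d - ?Q d) * log_fps + ?Q d * (log_fps - ?Q 1)
      + fps_const (of_nat d / 4) * fps_X ^ 4 = log_fps ^ Suc d - ?Q (Suc d)"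
    using Q by (simp only: ring_distribs power_Suc right_diff_distrib left_diff_distrib) (simp add: algebra_simps)
  finally show ?case .
qed

text \<open>The numbers w_(d,k) of the overview.\<close>

definition log_egf_coeff :: "nat \<Rightarrow> nat \<Rightarrow> rat" where
  "log_egf_coeff d k = fact k * (log_fps ^ d) $ k"

lemma log_egf_coeff_mod_2: "pow2_dvd 1 (log_egf_coeff d k - of_nat (if k = 0 then 1 else if k = 2 then d else 0))"
  using hurwitzD[OF hurwitz_log_fps_power, of k d]
  by (simp add: log_egf_coeff_def right_diff_distrib distrib_left fps_X_power_nth fact_numeral split: if_splits)

lemma log_egf_coeff_0 [simp]: "log_egf_coeff d 0 = 1"
  by (simp add: log_egf_coeff_def log_fps_def fps_power_zeroth)

lemma log_egf_coeff_integral: "pow2_dvd 0 (log_egf_coeff d k)"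
proof -
  define c where "c = (if k = 0 then 1 else if k = 2 then d else 0)"
  have "pow2_dvd 0 (log_egf_coeff d k - of_nat c)"
    unfolding c_def by (rule pow2_dvd_antimono[OF log_egf_coeff_mod_2]) simp
  from pow2_dvd_add[OF this pow2_dvd_0_of_nat[of c]] show ?thesis
    by simp
qed

section \<open>Coefficients in the basis of shifted falling factorials\<close>

text \<open>Up to sign, \<open>\<tau>\<close> of the partition with \<open>d\<close> parts, all equal to 1.\<close>

definition ones_term :: "nat \<Rightarrow> int \<Rightarrow> nat \<Rightarrow> rat" where
  "ones_term n s d = fact n / fact (n - d) * (of_int s gchoose d) * (- 1 / 2) ^ d"

text \<open>Up to sign, the sum of \<open>\<tau>\<^sub>v\<close> over the partitions \<open>v\<close> of weight \<open>m\<close>, grouped by \<open>d = \<Sum>v\<^sub>i\<close>.\<close>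

definition shifted_coeff :: "nat \<Rightarrow> int \<Rightarrow> nat \<Rightarrow> rat" where
  "shifted_coeff n s m = (\<Sum>d\<le>m. of_nat ((n - d) choose (m - d)) * log_egf_coeff d (m - d) * ones_term n s d)"

text \<open>Splitting n!/(n-m)! into n!/(n-d)!, (m-d)! and a binomial coefficient supplies the
  factorials that make each factor 2-integral apart from \<open>ones_term\<close>.\<close>

lemma shifted_coeff_conv_todd:
  assumes "m \<le> n"
  shows "fact n / fact (n - m) * (todd_fps powi (s + int m + 1) * fps_exp 1) $ m = shifted_coeff n s m"
  unfolding shifted_coeff_def todd_fps_powi_exp_nth sum_distrib_left
proof (intro sum.cong refl)
  fix d assume "d \<in> {..m}"
  with assms have "of_nat ((n - d) choose (m - d)) = (fact (n - d) / (fact (m - d) * fact (n - m)) :: rat)"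
    by (simp add: binomial_fact)
  then show "fact n / fact (n - m) * ((of_int s gchoose d) * (- 1 / 2) ^ d * (log_fps ^ d) $ (m - d)) =
      of_nat ((n - d) choose (m - d)) * log_egf_coeff d (m - d) * ones_term n s d"
    by (simp only: log_egf_coeff_def ones_term_def) simp
qed

section \<open>Expansion of the Bernoulli polynomials\<close>

lemma poly_bernpoly: "poly (bernpoly n l) x = fact n * (todd_fps powi l * fps_exp x) $ n"
  by (simp add: bernpoly_def fps_bernoulli_def fps_mult_nth poly_sum poly_monom flip: todd_fps_def)

text \<open>The basis is centred at 1, where all its members but the constant one vanish; the value
  at 1 is then a single coefficient.\<close>

definition shifted_ffact :: "nat \<Rightarrow> rat poly" where
  "shifted_ffact j = (\<Prod>i<j. [:- of_nat (Suc i), 1:])"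

lemma poly_shifted_ffact: "poly (shifted_ffact j) (x + 1) = fact j * (x gchoose j)"
  by (simp add: shifted_ffact_def poly_prod gbinomial_prod_rev atLeast0LessThan)

lemma poly_shifted_ffact_1: "poly (shifted_ffact j) 1 = (if j = 0 then 1 else 0)"
  using poly_shifted_ffact[of j 0] binomial_gbinomial[of 0 j, where 'a = rat] by (cases j) auto

lemma poly_shifted_ffact_0: "poly (shifted_ffact j) 0 = (-1) ^ j * fact j"
  using poly_shifted_ffact[of j "-1"] binomial_gbinomial[of j j, where 'a = rat]
  by (simp add: gbinomial_minus)

lemma coeff_shifted_ffact:
  "pow2_dvd 0 (coeff (shifted_ffact j) i)" "i > j \<Longrightarrow> coeff (shifted_ffact j) i = 0"
  "coeff (shifted_ffact j) j = 1"
proof -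
  have "(\<forall>i. pow2_dvd 0 (coeff (shifted_ffact j) i)) \<and> (\<forall>i>j. coeff (shifted_ffact j) i = 0)
      \<and> coeff (shifted_ffact j) j = 1"
  proof (induction j)
    case (Suc j)
    have *: "shifted_ffact (Suc j) = pCons 0 (shifted_ffact j) - smult (of_nat (Suc j)) (shifted_ffact j)"
      by (simp add: shifted_ffact_def mult.commute del: of_nat_Suc)
    have "pow2_dvd 0 (coeff (shifted_ffact (Suc j)) i)" for i
      using Suc unfolding *
      by (auto simp: coeff_pCons split: nat.splits simp del: of_nat_Suc
        intro!: pow2_dvd_diff pow2_dvd_mult_left[OF pow2_dvd_0_of_nat])
    with Suc show ?case
      unfolding * by (auto simp: coeff_pCons split: nat.splits)
  qed (auto simp: shifted_ffact_def coeff_pCons split: nat.splits)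
  then show "pow2_dvd 0 (coeff (shifted_ffact j) i)" "i > j \<Longrightarrow> coeff (shifted_ffact j) i = 0"
    "coeff (shifted_ffact j) j = 1"
    by auto
qed

text \<open>Allows the expansion to be checked at natural \<open>x\<close> only, where e^(t x) = (1
  + u)^x is an ordinary power.\<close>

lemma poly_eqI_nat_shift:
  fixes p q :: "'a::field_char_0 poly"
  assumes "\<And>x :: nat. poly p (of_nat x + 1) = poly q (of_nat x + 1)"
  shows "p = q"
proof (rule ccontr)
  assume "p \<noteq> q"
  then have "finite {x. poly (p - q) x = 0}"
    by (intro poly_roots_finite) simp
  moreover have "range (\<lambda>x :: nat. of_nat x + 1 :: 'a) \<subseteq> {x. poly (p - q) x = 0}"
    using assms by auto
  ultimately have "finite (range (\<lambda>x :: nat. of_nat x + 1 :: 'a))"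
    by (rule rev_finite_subset)
  moreover have "inj (\<lambda>x :: nat. of_nat x + 1 :: 'a)"
    by (auto simp: inj_on_def)
  ultimately show False
    using finite_imageD by fastforce
qed

text \<open>Expand e^(t (x+1)) = (1 + u)^x e^t in powers of u = e^t - 1. Each u^j turns j Todd
  factors into t^j, leaving the exponent l - j = s + (n - j) + 1 with the same s for all j.\<close>

lemma bernpoly_expansion:
  "bernpoly n l = (\<Sum>j\<le>n. smult (shifted_coeff n (l - int n - 1) (n - j)) (shifted_ffact j))"
proof (rule poly_eqI_nat_shift)
  fix x :: nat
  let ?e = "fps_exp 1 - 1 :: rat fps" and ?s = "l - int n - 1"
  have "(1 + fps_X) ^ x oo ?e = fps_exp 1 ^ x"
    by (simp flip: fps_compose_power add: fps_compose_add_distrib)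
  then have exp: "fps_exp (of_nat x + 1) = (fps_binomial (of_nat x) oo ?e) * fps_exp 1"
    by (simp add: fps_exp_add_mult fps_exp_power_mult fps_binomial_of_nat)
  have nth: "fact n * (?e ^ j * (todd_fps powi l * fps_exp 1)) $ n = fact j * shifted_coeff n ?s (n - j)"
    if "j \<le> n" for j
  proof -
    have "todd_fps powi l = todd_fps powi (?s + int (n - j) + 1) * todd_fps ^ j"
      using fps_powi_add[OF todd_fps_nth_0, of "l - int j" "int j"] that
      by (simp add: of_nat_diff algebra_simps)
    then have "?e ^ j * (todd_fps powi l * fps_exp 1) =
        (todd_fps * ?e) ^ j * (todd_fps powi (?s + int (n - j) + 1) * fps_exp 1)"
      by (simp only: power_mult_distrib mult_ac)
    also have "\<dots> $ n = (todd_fps powi (?s + int (n - j) + 1) * fps_exp 1) $ (n - j)"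
      unfolding todd_fps_times using that by (simp add: fps_X_power_mult_nth)
    finally show ?thesis
      using shifted_coeff_conv_todd[of "n - j" n ?s] that by (simp add: field_simps)
  qed
  have "todd_fps powi l * fps_exp (of_nat x + 1) =
      (fps_binomial (of_nat x) oo ?e) * (todd_fps powi l * fps_exp 1)"
    by (simp add: exp mult_ac)
  then have "poly (bernpoly n l) (of_nat x + 1) =
      fact n * ((fps_binomial (of_nat x) oo ?e) * (todd_fps powi l * fps_exp 1)) $ n"
    by (simp only: poly_bernpoly)
  also have "\<dots> = (\<Sum>j\<le>n. (of_nat x gchoose j) * (fact n * (?e ^ j * (todd_fps powi l * fps_exp 1)) $ n))"
    by (subst fps_compose_mult_nth) (simp_all add: sum_distrib_left mult_ac)
  also have "\<dots> = (\<Sum>j\<le>n. (of_nat x gchoose j) * (fact j * shifted_coeff n ?s (n - j)))"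
    using nth by (intro sum.cong) auto
  also have "\<dots> = poly (\<Sum>j\<le>n. smult (shifted_coeff n ?s (n - j)) (shifted_ffact j)) (of_nat x + 1)"
    by (simp add: poly_sum poly_shifted_ffact mult_ac)
  finally show "poly (bernpoly n l) (of_nat x + 1) = \<dots>" .
qed

lemma poly_bernpoly_1: "poly (bernpoly n l) 1 = shifted_coeff n (l - int n - 1) n"
  by (simp add: bernpoly_expansion poly_sum poly_shifted_ffact_1 if_distrib cong: if_cong)

lemma bernnum_conv_shifted_coeff:
  "bernnum n l = (\<Sum>j\<le>n. shifted_coeff n (l - int n - 1) (n - j) * ((-1) ^ j * fact j))"
  by (simp add: bernnum_def bernpoly_expansion poly_sum poly_shifted_ffact_0)

lemma coeff_bernpoly:
  fixes l :: int
  assumes "m \<le> n"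
  defines "b \<equiv> shifted_coeff n (l - int n - 1)"
  shows "coeff (bernpoly n l) (n - m) = b m + (\<Sum>d<m. coeff (shifted_ffact (n - d)) (n - m) * b d)"
proof -
  have "coeff (bernpoly n l) (n - m) = (\<Sum>j\<le>n. b (n - j) * coeff (shifted_ffact j) (n - m))"
    by (simp add: bernpoly_expansion coeff_sum b_def)
  also have "\<dots> = (\<Sum>d\<le>n. b d * coeff (shifted_ffact (n - d)) (n - m))"
    by (rule sum.reindex_bij_witness[of _ "\<lambda>d. n - d" "\<lambda>d. n - d"]) auto
  \<comment> \<open>For \<open>d > m\<close> the basis polynomial has degree
    \<open>n - d < n - m\<close>.\<close>
  also have "\<dots> = (\<Sum>d\<le>m. b d * coeff (shifted_ffact (n - d)) (n - m))"
    using assms by (intro sum.mono_neutral_right) (auto simp: coeff_shifted_ffact)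
  also have "{..m} = insert m {..<m}"
    by auto
  finally show ?thesis
    by (simp add: coeff_shifted_ffact mult.commute)
qed

section \<open>From the maximum pole to the individual terms\<close>

text \<open>Forward substitution in a unitriangular system with 2-integral entries loses no
  divisibility.\<close>

lemma pow2_dvd_triangular:
  fixes x y :: "nat \<Rightarrow> rat"
  assumes y: "\<And>m. m \<le> n \<Longrightarrow> y m = x m + (\<Sum>d<m. c m d * x d)"
    and c: "\<And>m d. pow2_dvd 0 (c m d)"
    and k: "\<And>m. m \<le> n \<Longrightarrow> pow2_dvd k (y m)"
    and "m \<le> n"
  shows "pow2_dvd k (x m)"
  using \<open>m \<le> n\<close>
proof (induction m rule: less_induct)
  case (less m)
  have "pow2_dvd k (y m - (\<Sum>d<m. c m d * x d))"
    using less by (intro pow2_dvd_diff k pow2_dvd_sum pow2_dvd_mult_left[OF c]) auto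
  with less y show ?case
    by simp
qed

lemma pow2_dvd_coeff_bernpoly: "pow2_dvd (- max_pole (bernpoly n l)) (coeff (bernpoly n l) i)"
proof (cases "i \<le> degree (bernpoly n l)")
  case True
  have "coeff (bernpoly n l) n = 1"
    using coeff_bernpoly[of 0 n l] by (simp add: shifted_coeff_def ones_term_def)
  then have "bernpoly n l \<noteq> 0"
    by auto
  from max_pole_eq[OF this] True show ?thesis
    unfolding le_\<nu>\<^sub>2_iff[symmetric] by (auto intro!: Min_le)
qed (simp add: coeff_eq_0)

text \<open>Two triangular systems are inverted in succession: from the polynomial coefficients to
  the b_m, and from these to the t_d.\<close>

lemma pow2_dvd_ones_term:
  assumes "d \<le> n"
  shows "pow2_dvd (- max_pole (bernpoly n l)) (ones_term n (l - int n - 1) d)"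
proof (rule pow2_dvd_triangular[OF _ _ _ assms])
  show "shifted_coeff n (l - int n - 1) m = ones_term n (l - int n - 1) m +
    (\<Sum>d<m. of_nat ((n - d) choose (m - d)) * log_egf_coeff d (m - d) * ones_term n (l - int n - 1) d)" for m
  proof -
    have "{..m} = insert m {..<m}"
      by auto
    then show ?thesis
      by (simp add: shifted_coeff_def)
  qed
  show "pow2_dvd 0 (of_nat ((n - d) choose (m - d)) * log_egf_coeff d (m - d))" for m d
    by (intro pow2_dvd_mult_left pow2_dvd_0_of_nat log_egf_coeff_integral)
  show "pow2_dvd (- max_pole (bernpoly n l)) (shifted_coeff n (l - int n - 1) m)" if "m \<le> n" for m
    by (rule pow2_dvd_triangular[OF coeff_bernpoly _ _ that])
      (simp_all add: coeff_shifted_ffact pow2_dvd_coeff_bernpoly)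
qed

lemma pow2_dvd_shifted_coeff:
  assumes "\<And>d. d \<le> n \<Longrightarrow> pow2_dvd k (ones_term n s d)" "m \<le> n"
  shows "pow2_dvd k (shifted_coeff n s m)"
  unfolding shifted_coeff_def using assms
  by (intro pow2_dvd_sum pow2_dvd_mult_left[OF pow2_dvd_mult_left[OF pow2_dvd_0_of_nat log_egf_coeff_integral]]) auto

text \<open>Replacing each w_(d,m-d) by its residue modulo 2 leaves only d = m, with weight 1, and d
  = m - 2, with weight d.\<close>

lemma shifted_coeff_mod_2:
  assumes "\<And>d. d \<le> n \<Longrightarrow> pow2_dvd k (ones_term n s d)" "m \<le> n"
  shows "pow2_dvd (k + 1) (shifted_coeff n s m - (ones_term n s m +
    (if m \<ge> 2 then of_nat ((n - (m - 2)) choose 2) * of_nat (m - 2) * ones_term n s (m - 2) else 0)))"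
proof -
  define c where "c = (\<lambda>d k :: nat. of_nat (if k = 0 then 1 else if k = 2 then d else 0) :: rat)"
  define f where "f = (\<lambda>d. of_nat ((n - d) choose (m - d)) * c d (m - d) * ones_term n s d)"
  have "(\<Sum>d\<le>m. f d) = (\<Sum>d\<in>{m} \<union> (if m \<ge> 2 then {m - 2} else {}). f d)"
    by (rule sum.mono_neutral_right) (auto simp: f_def c_def)
  also have "\<dots> = ones_term n s m +
    (if m \<ge> 2 then of_nat ((n - (m - 2)) choose 2) * of_nat (m - 2) * ones_term n s (m - 2) else 0)"
    by (auto simp: f_def c_def)
  finally have "shifted_coeff n s m - (ones_term n s m +
    (if m \<ge> 2 then of_nat ((n - (m - 2)) choose 2) * of_nat (m - 2) * ones_term n s (m - 2) else 0)) =
    (\<Sum>d\<le>m. of_nat ((n - d) choose (m - d)) * (ones_term n s d * (log_egf_coeff d (m - d) - c d (m - d))))"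
    unfolding shifted_coeff_def f_def by (simp add: sum_subtractf algebra_simps)
  also have "pow2_dvd (k + 1) \<dots>"
    using assms unfolding c_def
    by (intro pow2_dvd_sum pow2_dvd_mult_left[OF pow2_dvd_0_of_nat] pow2_dvd_mult log_egf_coeff_mod_2) auto
  finally show ?thesis .
qed

text \<open>The factor n - d comes from the falling factorial, (s - d) / (d + 1) from the binomial
  coefficient, and -1/2 from the power.\<close>

lemma ones_term_rec:
  assumes "d < n"
  shows "of_nat (2 * Suc d) * ones_term n s (Suc d) = - (of_nat (n - d) * of_int (s - int d) * ones_term n s d)"
proof -
  have fact: "fact (n - d) = of_nat (n - d) * (fact (n - Suc d) :: rat)"
    using assms by (metis Suc_diff_Suc fact_Suc)
  have "of_nat (Suc d) * (of_int s gchoose Suc d) = of_int (s - int d) * (of_int s gchoose d :: rat)"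
    using gbinomial_mult_1[of "of_int s :: rat" d] by (simp add: algebra_simps)
  moreover have "of_nat (2 * Suc d) * ones_term n s (Suc d) =
      - (fact n / fact (n - Suc d) * (- 1 / 2) ^ d * (of_nat (Suc d) * (of_int s gchoose Suc d)))"
    unfolding ones_term_def power_Suc of_nat_mult by (simp del: of_nat_Suc)
  ultimately show ?thesis
    unfolding ones_term_def fact using assms by simp
qed

text \<open>At m = n the binomial factor is 2 choose 2, so the second term has weight n - 2, which
  is even for even n. For odd n the weight is kept, since it yields \<tau> of
  \<open>part_u'' n\<close> up to sign.\<close>

lemma shifted_coeff_top_mod_2:
  assumes "\<And>d. d \<le> n \<Longrightarrow> pow2_dvd k (ones_term n s d)"
  shows "pow2_dvd (k + 1) (shifted_coeff n s n - (ones_term n s n +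
    (if n \<ge> 3 \<and> odd n then of_nat (n - 2) * ones_term n s (n - 2) else 0)))"
proof (cases "n \<ge> 3 \<and> even n")
  case True
  with shifted_coeff_mod_2[of n k s n] assms
  have "pow2_dvd (k + 1) (shifted_coeff n s n - (ones_term n s n + of_nat (n - 2) * ones_term n s (n - 2)))"
    by (simp add: numeral_eq_Suc)
  moreover have "pow2_dvd (k + 1) (of_nat (n - 2) * ones_term n s (n - 2))"
    using pow2_dvd_even_mult[of k "ones_term n s (n - 2)" "int (n - 2)"] assms True by simp
  ultimately have "pow2_dvd (k + 1) (shifted_coeff n s n
      - (ones_term n s n + of_nat (n - 2) * ones_term n s (n - 2)) + of_nat (n - 2) * ones_term n s (n - 2))"
    by (rule pow2_dvd_add)
  with True show ?thesis
    by simp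
next
  case False
  then have "n = 0 \<or> n = 1 \<or> n = 2 \<or> n \<ge> 3 \<and> odd n"
    by linarith
  with shifted_coeff_mod_2[of n k s n] assms show ?thesis
    by (auto simp: numeral_eq_Suc)
qed

section \<open>Comparing the values at 0 and 1\<close>

text \<open>At m = n - 1 the congruence leaves t_(n-1) and 3 (n-3) t_(n-3); the recurrence shows
  that each vanishes to the next order.\<close>

lemma pow2_dvd_pred_shifted_coeff:
  fixes l :: int
  defines "s \<equiv> \<lambda>n. l - int n - 1"
  assumes T: "\<And>d. d \<le> n \<Longrightarrow> pow2_dvd k (ones_term n (s n) d)"
    and l: "\<nu>\<^sub>2 (of_int l) \<le> \<nu>\<^sub>2 (of_nat n)" and n: "n > 0"
  shows "pow2_dvd (k + 1) (shifted_coeff n (s n) (n - 1))"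
proof -
  let ?T = "ones_term n (s n)"
  have "\<nu>\<^sub>2 (of_nat n) \<noteq> \<infinity>"
    using n by (simp add: \<nu>\<^sub>2_def split: prod.splits)
  with l have "(of_int l :: rat) \<noteq> 0"
    by (auto simp: \<nu>\<^sub>2_def)
  then obtain a p q where pq: "odd p" "odd q" "of_int l = 2 powi a * of_int p / (of_int q :: rat)"
    "\<nu>\<^sub>2 (of_int l) = Fin a"
    by (rule rat_pow2_decomp)
  with l have "pow2_dvd a (of_nat n)"
    by (simp add: le_\<nu>\<^sub>2_iff)
  then obtain r t where rt: "odd t" "of_nat n = 2 powi a * of_int r / (of_int t :: rat)"
    by (auto simp: pow2_dvd_def)
  \<comment> \<open>At \<open>d = n - 1\<close> the factor \<open>s n - d\<close> of the recurrence
    is \<open>l - 2 * n\<close>.\<close>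
  have "of_nat (2 * n) * ?T n = - (of_int (l - 2 * int n) * ?T (n - 1))"
    using ones_term_rec[of "n - 1" n "s n"] n by (simp add: s_def of_nat_diff algebra_simps)
  then have "of_int l * ?T (n - 1) = of_nat n * (2 * (?T (n - 1) - ?T n))"
    by (simp add: algebra_simps)
  then have "2 powi a * (of_int (p * t) * ?T (n - 1)) =
      2 powi a * (of_int (q * r) * (2 * (?T (n - 1) - ?T n)))"
    unfolding pq(3) rt(2) using pq(2) rt(1) by (simp add: field_simps odd_int_neq_0)
  \<comment> \<open>After cancelling the common power of 2, the left factor is odd; the bound on the
    valuation of \<open>l\<close> is what makes \<open>r\<close> an integer.\<close>
  then have "of_int (p * t) * ?T (n - 1) = of_int (q * r) * (2 * (?T (n - 1) - ?T n))"
    unfolding mult_cancel_left by simp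
  also have "pow2_dvd (k + 1) \<dots>"
    by (intro pow2_dvd_mult_left[OF pow2_dvd_0_of_int] pow2_dvd_double pow2_dvd_diff T) auto
  finally have T1: "pow2_dvd (k + 1) (?T (n - 1))"
    by (rule pow2_dvd_odd_mult_cancel) (use pq rt in auto)
  have T3: "pow2_dvd (k + 1) (of_nat (n - 3) * ?T (n - 3))" if "n \<ge> 3"
  proof (cases "even n")
    case False
    with that show ?thesis
      using pow2_dvd_even_mult[of k "?T (n - 3)" "int (n - 3)"] T[of "n - 3"] by simp
  next
    case True
    with that have n4: "n \<ge> 4"
      by presburger
    then have "Suc (n - 4) = n - 3" "n - (n - 4) = 4"
      by auto
    \<comment> \<open>At \<open>d = n - 4\<close> the factor \<open>n - d\<close> is 4, one power of
      2 more than on the left.\<close>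
    with ones_term_rec[of "n - 4" n "s n"] n4
    have "of_nat (2 * (n - 3)) * ?T (n - 3) = - (4 * of_int (s n - int (n - 4)) * ?T (n - 4))"
      by simp
    then have "2 * (of_nat (n - 3) * ?T (n - 3)) = 2 * (of_int (- (s n - int (n - 4))) * (2 * ?T (n - 4)))"
      unfolding of_nat_mult by (simp only: of_int_minus of_nat_numeral mult_minus_left mult_minus_right mult_ac)
    then have "of_nat (n - 3) * ?T (n - 3) = of_int (- (s n - int (n - 4))) * (2 * ?T (n - 4))"
      unfolding mult_cancel_left by simp
    also have "pow2_dvd (k + 1) \<dots>"
      by (intro pow2_dvd_mult_left[OF pow2_dvd_0_of_int] pow2_dvd_double T) auto
    finally show ?thesis .
  qed
  let ?R = "if n - 1 \<ge> 2 then of_nat ((n - (n - 1 - 2)) choose 2) * of_nat (n - 1 - 2) * ?T (n - 1 - 2) else 0"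
  have "pow2_dvd (k + 1) ?R"
  proof (cases "n \<ge> 3")
    case True
    then have "n - 1 \<ge> 2" "n - 1 - 2 = n - 3"
      by auto
    then show ?thesis
      using T3[OF True]
      by (simp only: if_True mult.assoc pow2_dvd_mult_left[OF pow2_dvd_0_of_nat])
  qed auto
  moreover have "pow2_dvd (k + 1) (shifted_coeff n (s n) (n - 1) - (?T (n - 1) + ?R))"
    by (rule shifted_coeff_mod_2) (auto simp: T)
  ultimately have "pow2_dvd (k + 1)
      (shifted_coeff n (s n) (n - 1) - (?T (n - 1) + ?R) + (?T (n - 1) + ?R))"
    using T1 by (intro pow2_dvd_add)
  then show ?thesis
    by simp
qed

text \<open>At 0 the coefficient b_(n-j) carries the weight (-1)^j j!, even for j \<ge> 2. The term
  j = 0 is the value at 1, and j = 1 gives -b_(n-1), which vanishes to this order.\<close>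

lemma bernnum_cong_poly_1:
  assumes "\<nu>\<^sub>2 (of_int l) \<le> \<nu>\<^sub>2 (of_nat n)"
  shows "pow2_dvd (- max_pole (bernpoly n l) + 1) (bernnum n l - poly (bernpoly n l) 1)"
proof (cases "n = 0")
  case True
  then show ?thesis
    by (simp add: poly_bernpoly_1 bernnum_conv_shifted_coeff)
next
  case False
  define b where "b = shifted_coeff n (l - int n - 1)"
  define k where "k = - max_pole (bernpoly n l)"
  have T: "pow2_dvd k (ones_term n (l - int n - 1) d)" if "d \<le> n" for d
    using pow2_dvd_ones_term[OF that, of l] by (simp add: k_def)
  have "{..n} = {0, 1} \<union> {2..n}"
    using False by auto
  then have "bernnum n l = b n - b (n - 1) + (\<Sum>j=2..n. b (n - j) * ((-1) ^ j * fact j))"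
    by (simp add: bernnum_conv_shifted_coeff b_def)
  then have "bernnum n l - poly (bernpoly n l) 1 =
      - b (n - 1) + (\<Sum>j=2..n. of_int ((-1) ^ j * fact j) * b (n - j))"
    by (simp add: poly_bernpoly_1 b_def mult_ac)
  also have "pow2_dvd (k + 1) \<dots>"
  proof (intro pow2_dvd_add pow2_dvd_sum pow2_dvd_even_mult)
    show "pow2_dvd (k + 1) (- b (n - 1))"
      using pow2_dvd_pred_shifted_coeff[of n k l] T assms False by (simp add: b_def)
    fix j assume "j \<in> {2..n}"
    then have "even (fact j :: nat)"
      by (intro dvd_fact) auto
    then show "even ((-1) ^ j * fact j :: int)"
      by (metis even_mult_iff even_of_nat of_nat_fact)
    show "pow2_dvd k (b (n - j))"
      unfolding b_def by (rule pow2_dvd_shifted_coeff) (auto simp: T)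
  qed
  finally show ?thesis
    by (simp add: k_def)
qed

text \<open>Having exact valuation \<open>k\<close> depends only on the class modulo 2^(k+1), and
  after the index shift both notions refer to the polynomial of order \<open>l\<close>.\<close>

lemma AMPC_iff_SAMPC:
  assumes "\<nu>\<^sub>2 (of_int l) \<le> \<nu>\<^sub>2 (of_nat n)"
  shows "AMPC n l \<longleftrightarrow> SAMPC n (l - 1)"
proof -
  define k where "k = - max_pole (bernpoly n l)"
  have *: "pow2_dvd (k + 1) (bernnum n l - poly (bernpoly n l) 1)"
    using bernnum_cong_poly_1[OF assms] by (simp add: k_def)
  then have "pow2_dvd k (bernnum n l - poly (bernpoly n l) 1)"
    by (rule pow2_dvd_antimono) simp
  with * show ?thesis
    unfolding AMPC_def SAMPC_def diff_add_cancel k_def[symmetric] \<nu>\<^sub>2_eq_Fin_iff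
    by (simp only: pow2_dvd_cong)
qed

section \<open>Valuations of the distinguished partitions\<close>

lemma sum_binary_digits:
  assumes "m \<le> N"
  shows "(\<Sum>i<N. (m div 2 ^ i) mod 2) = \<sigma>\<^sub>2 m"
  unfolding \<sigma>\<^sub>2_def
proof (rule sum.mono_neutral_right)
  have "m < 2 ^ i" if "m \<le> i" for i
    using that less_exp[of i] by linarith
  then show "\<forall>i\<in>{..<N} - {..<m}. (m div 2 ^ i) mod 2 = 0"
    by (simp add: not_less)
qed (use assms in auto)

lemma \<sigma>\<^sub>2_rec: "\<sigma>\<^sub>2 m = m mod 2 + \<sigma>\<^sub>2 (m div 2)"
proof -
  have "\<sigma>\<^sub>2 m = (\<Sum>i<Suc m. (m div 2 ^ i) mod 2)"
    by (rule sum_binary_digits[symmetric]) simp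
  also have "\<dots> = m mod 2 + (\<Sum>i<m. (m div 2 div 2 ^ i) mod 2)"
    unfolding sum.lessThan_Suc_shift by (simp add: div_mult2_eq)
  also have "(\<Sum>i<m. (m div 2 div 2 ^ i) mod 2) = \<sigma>\<^sub>2 (m div 2)"
    by (rule sum_binary_digits) simp
  finally show ?thesis .
qed

text \<open>The carry rule: n + 1 has valuation
  \<open>\<sigma>\<^sub>2 n + 1 - \<sigma>\<^sub>2 (Suc n)\<close>, written without subtraction.
  Halving reduces odd n = 2 m + 1 to m.\<close>

lemma \<sigma>\<^sub>2_Suc: "\<exists>c. odd c \<and> Suc n * 2 ^ \<sigma>\<^sub>2 (Suc n) = 2 ^ Suc (\<sigma>\<^sub>2 n) * c"
proof (induction n rule: less_induct)
  case (less n)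
  show ?case
  proof (cases "even n")
    case True
    then have "Suc n mod 2 = 1" "n mod 2 = 0" "Suc n div 2 = n div 2"
      by auto
    then have "\<sigma>\<^sub>2 (Suc n) = Suc (\<sigma>\<^sub>2 n)"
      using \<sigma>\<^sub>2_rec[of "Suc n"] \<sigma>\<^sub>2_rec[of n] by simp
    with True show ?thesis
      by (intro exI[of _ "Suc n"]) simp
  next
    case False
    then obtain m where m: "n = Suc (2 * m)"
      by (auto elim: oddE)
    then obtain c where c: "odd c" "Suc m * 2 ^ \<sigma>\<^sub>2 (Suc m) = 2 ^ Suc (\<sigma>\<^sub>2 m) * c"
      using less[of m] by auto
    have "\<sigma>\<^sub>2 n = Suc (\<sigma>\<^sub>2 m)" "\<sigma>\<^sub>2 (Suc n) = \<sigma>\<^sub>2 (Suc m)"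
      using \<sigma>\<^sub>2_rec[of n] \<sigma>\<^sub>2_rec[of "Suc n"] by (simp_all add: m)
    with c show ?thesis
      by (intro exI[of _ c]) (simp add: m)
  qed
qed

text \<open>Legendre's formula in multiplicative form; the digit sums telescope along the factors of
  n!.\<close>

lemma legendre_2: "\<exists>c. odd c \<and> fact n * 2 ^ \<sigma>\<^sub>2 n = 2 ^ n * (c :: nat)"
proof (induction n)
  case 0
  then show ?case
    by (simp add: \<sigma>\<^sub>2_def)
next
  case (Suc n)
  then obtain c where c: "odd c" "fact n * 2 ^ \<sigma>\<^sub>2 n = 2 ^ n * (c :: nat)"
    by blast
  obtain d where d: "odd d" "Suc n * 2 ^ \<sigma>\<^sub>2 (Suc n) = 2 ^ Suc (\<sigma>\<^sub>2 n) * d"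
    using \<sigma>\<^sub>2_Suc by blast
  have "fact (Suc n) * 2 ^ \<sigma>\<^sub>2 (Suc n) = fact n * (Suc n * 2 ^ \<sigma>\<^sub>2 (Suc n))"
    by (simp add: algebra_simps)
  also have "\<dots> = fact n * 2 ^ \<sigma>\<^sub>2 n * (2 * d)"
    by (simp only: d power_Suc mult_ac)
  also have "\<dots> = 2 ^ Suc n * (c * d)"
    unfolding c by simp
  finally show ?case
    using c d by (intro exI[of _ "c * d"]) simp
qed

lemma fact_div_power_2:
  obtains c :: int where "odd c" "(fact n / 2 ^ n :: rat) = 2 powi (- int (\<sigma>\<^sub>2 n)) * of_int c"
proof -
  obtain c :: nat where c: "odd c" "fact n * 2 ^ \<sigma>\<^sub>2 n = 2 ^ n * c"
    using legendre_2 by blast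
  then have "(of_nat (fact n * 2 ^ \<sigma>\<^sub>2 n) :: rat) = of_nat (2 ^ n * c)"
    by simp
  then have "(fact n / 2 ^ n :: rat) = 2 powi (- int (\<sigma>\<^sub>2 n)) * of_int (int c)"
    by (simp add: power_int_minus field_simps)
  with c that show thesis
    by (metis even_of_nat)
qed

section \<open>The two partitions\<close>

lemma \<tau>_part_u: "\<tau>_part n l (part_u n) = (-1) ^ n * ones_term n (l - int n - 1) n"
proof -
  have "part_supp (part_u n) = (if n = 0 then {} else {1})"
    by (auto simp: part_supp_def part_u_def)
  then show ?thesis
    by (auto simp: \<tau>_part_def t_part_def part_multinomial_def part_weight_def part_size_def ones_term_def part_u_def
      power_minus' field_simps simp flip: power_mult_distrib)
qed

text \<open>The multinomial coefficient is n - 2. The denominator 2^(n-3) * 4 equals 2! * 2^(n-2)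
  from \<open>ones_term\<close>, whose sign is negative for odd n.\<close>

lemma \<tau>_part_u'':
  assumes "n \<ge> 3" "odd n"
  shows "\<tau>_part n l (part_u'' n) = - (of_nat (n - 2) * ones_term n (l - int n - 1) (n - 2))"
proof -
  obtain m where m: "n = m + 3"
    using assms le_Suc_ex by (metis add.commute)
  \<comment> \<open>Only an inclusion, as the entry at 1 is zero for \<open>n = 3\<close>.\<close>
  have supp: "part_supp (part_u'' n) \<subseteq> {1, 3}"
    by (auto simp: part_supp_def part_u''_def)
  have sum: "(\<Sum>i\<in>part_supp (part_u'' n). f i * part_u'' n i) = f 1 * m + f 3" for f :: "nat \<Rightarrow> nat"
  proof -
    have "(\<Sum>i\<in>part_supp (part_u'' n). f i * part_u'' n i) = (\<Sum>i\<in>{1, 3}. f i * part_u'' n i)"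
      using supp by (intro sum.mono_neutral_left) (auto simp: part_supp_def)
    then show ?thesis
      by (simp add: part_u''_def m)
  qed
  have prod: "(\<Prod>i\<in>part_supp (part_u'' n). f i (part_u'' n i)) = f 1 m * f 3 1"
    if "\<And>i. f i 0 = 1" for f :: "nat \<Rightarrow> nat \<Rightarrow> rat"
  proof -
    have "(\<Prod>i\<in>part_supp (part_u'' n). f i (part_u'' n i)) = (\<Prod>i\<in>{1, 3}. f i (part_u'' n i))"
      using supp that by (intro prod.mono_neutral_left) (auto simp: part_supp_def)
    then show ?thesis
      by (simp add: part_u''_def m)
  qed
  have weight: "part_weight (part_u'' n) = n"
    using sum[of "\<lambda>i. i"] by (simp add: part_weight_def m)
  have size: "part_size (part_u'' n) = Suc m"
    using sum[of "\<lambda>_. 1"] by (simp add: part_size_def)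
  have multinomial: "part_multinomial (part_u'' n) = of_nat (Suc m)"
    using prod[of "\<lambda>_. fact"] by (simp add: part_multinomial_def size)
  have denom: "(\<Prod>i\<in>part_supp (part_u'' n). of_nat (i + 1) ^ part_u'' n i) = (2 ^ m * 4 :: rat)"
    using prod[of "\<lambda>i k. of_nat (i + 1) ^ k"] by simp
  have "even m"
    using assms by (simp add: m)
  then have "(- 1 / 2) ^ Suc m = (- 1 / (2 ^ m * 2) :: rat)"
    by (simp add: power_divide)
  then show ?thesis
    unfolding \<tau>_part_def t_part_def ones_term_def weight size multinomial denom
    by (simp add: m numeral_eq_Suc mult_ac del: power_Suc)
qed

section \<open>Assembling the three statements\<close>

theorem theorem5p13:
  fixes l :: int and n :: nat and M M' :: int
  assumes M: "M = max_pole (bernpoly n l)"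
    and M': "M' = max_pole (bernpoly n (l + 1))"
  shows
    \<comment> \<open>(a); the exclusive or is rendered as \<open>\<noteq>\<close> on truth values\<close>
    "((SAMPC n (l - 1) \<longleftrightarrow>
        ((\<nu>\<^sub>2 (\<tau>_part n l (part_u n)) = Fin (- M) \<and>
          Fin (- M) = \<nu>\<^sub>2 (poly (bernpoly n l) 1))
         \<noteq>
         (n \<ge> 3 \<and> odd n \<and> \<nu>\<^sub>2 (\<tau>_part n l (part_u'' n)) = Fin (- M) \<and>
          Fin (- M) = \<nu>\<^sub>2 (poly (bernpoly n l) 1))))
      \<and> \<nu>\<^sub>2 (\<tau>_part n l (part_u n)) =
          Fin (- int (\<sigma>\<^sub>2 n)) + \<nu>\<^sub>2 (of_int (l - int n - 1) gchoose n)
      \<and> (n \<ge> 3 \<and> odd n \<longrightarrow>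
          \<nu>\<^sub>2 (\<tau>_part n l (part_u'' n)) =
            Fin (1 - int (\<sigma>\<^sub>2 n)) + \<nu>\<^sub>2 (of_int (l - int n - 1) gchoose (n - 2))))
     \<and>
     (\<nu>\<^sub>2 (of_int l) \<le> \<nu>\<^sub>2 (of_nat n) \<longrightarrow>
        (AMPC n l \<longleftrightarrow> SAMPC n (l - 1)) \<and>
        (AMPC n l \<or> SAMPC n (l - 1) \<longrightarrow>
          \<nu>\<^sub>2 (bernnum n l) = \<nu>\<^sub>2 (poly (bernpoly n l) 1) \<and>
          \<nu>\<^sub>2 (poly (bernpoly n l) 1) = Fin (- M)))
     \<and>
     (\<nu>\<^sub>2 (of_int l) > \<nu>\<^sub>2 (of_nat n) \<longrightarrow>
        \<nu>\<^sub>2 (of_int (l + 1)) = 0 \<and>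
        (AMPC n (l + 1) \<longleftrightarrow> SAMPC n l) \<and>
        (AMPC n (l + 1) \<or> SAMPC n l \<longrightarrow>
          \<nu>\<^sub>2 (bernnum n (l + 1)) = \<nu>\<^sub>2 (poly (bernpoly n (l + 1)) 1) \<and>
          \<nu>\<^sub>2 (poly (bernpoly n (l + 1)) 1) = Fin (- M')))"
proof -
  define s where "s = l - int n - 1"
  have SAMPC_iff: "SAMPC n (l - 1) \<longleftrightarrow> \<nu>\<^sub>2 (poly (bernpoly n l) 1) = Fin (- M)"
    if "M = max_pole (bernpoly n l)" for l M
    using that by (simp add: SAMPC_def)
  have a: "SAMPC n (l - 1) \<longleftrightarrow>
        ((\<nu>\<^sub>2 (\<tau>_part n l (part_u n)) = Fin (- M) \<and>
          Fin (- M) = \<nu>\<^sub>2 (poly (bernpoly n l) 1))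
         \<noteq>
         (n \<ge> 3 \<and> odd n \<and> \<nu>\<^sub>2 (\<tau>_part n l (part_u'' n)) = Fin (- M) \<and>
          Fin (- M) = \<nu>\<^sub>2 (poly (bernpoly n l) 1)))"
  proof -
    define x where "x = ones_term n s n"
    \<comment> \<open>Without a partition \<open>part_u''\<close> the value is 0, whose infinite
      valuation makes the second alternative false.\<close>
    define y where "y = (if n \<ge> 3 \<and> odd n then of_nat (n - 2) * ones_term n s (n - 2) else 0)"
    define z where "z = poly (bernpoly n l) 1"
    have T: "pow2_dvd (- M) (ones_term n s d)" if "d \<le> n" for d
      using pow2_dvd_ones_term[OF that] by (simp add: M s_def)
    then have x: "pow2_dvd (- M) x" and y: "pow2_dvd (- M) y"
      by (auto simp: x_def y_def simp del: of_nat_diff intro!: pow2_dvd_mult_left[OF pow2_dvd_0_of_nat])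
    have z: "pow2_dvd (- M) z"
      unfolding z_def poly_bernpoly_1 by (rule pow2_dvd_shifted_coeff) (auto simp: T simp flip: s_def)
    have "pow2_dvd (- M + 1) (z - (x + y))"
      unfolding x_def y_def z_def poly_bernpoly_1 s_def[symmetric] using T
      by (rule shifted_coeff_top_mod_2)
    then have "pow2_dvd (- M + 1) z \<longleftrightarrow> pow2_dvd (- M + 1) (x + y)"
      by (rule pow2_dvd_cong)
    also have "\<dots> \<longleftrightarrow> (pow2_dvd (- M + 1) x \<longleftrightarrow> pow2_dvd (- M + 1) y)"
      by (rule pow2_dvd_Suc_add_iff[OF x y])
    finally have "\<nu>\<^sub>2 z = Fin (- M) \<longleftrightarrow> (\<nu>\<^sub>2 x = Fin (- M)) \<noteq> (\<nu>\<^sub>2 y = Fin (- M))"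
      using x y z by (auto simp: \<nu>\<^sub>2_eq_Fin_iff)
    moreover have "\<nu>\<^sub>2 (\<tau>_part n l (part_u n)) = \<nu>\<^sub>2 x"
      by (simp add: \<tau>_part_u \<nu>\<^sub>2_minus_one_power_mult x_def s_def)
    moreover have "\<nu>\<^sub>2 y = Fin (- M) \<longleftrightarrow>
        n \<ge> 3 \<and> odd n \<and> \<nu>\<^sub>2 (\<tau>_part n l (part_u'' n)) = Fin (- M)"
    proof (cases "n \<ge> 3 \<and> odd n")
      case True
      then have "\<nu>\<^sub>2 (\<tau>_part n l (part_u'' n)) = \<nu>\<^sub>2 y"
        using \<nu>\<^sub>2_minus_one_power_mult[of 1 y] by (simp add: \<tau>_part_u'' y_def s_def)
      with True show ?thesis
        by simp
    qed (auto simp: y_def \<nu>\<^sub>2_def)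
    \<comment> \<open>If \<open>z\<close> has another valuation, both alternatives fail by their
      last conjunct; otherwise exactly one of them holds.\<close>
    ultimately show ?thesis
      using SAMPC_iff[OF M] by (auto simp: z_def)
  qed
  have u: "\<nu>\<^sub>2 (\<tau>_part n l (part_u n)) =
      Fin (- int (\<sigma>\<^sub>2 n)) + \<nu>\<^sub>2 (of_int (l - int n - 1) gchoose n)"
  proof -
    obtain c :: int where c: "odd c" "(fact n / 2 ^ n :: rat) = 2 powi (- int (\<sigma>\<^sub>2 n)) * of_int c"
      by (rule fact_div_power_2)
    have "(-1) ^ n * (- 1 / 2) ^ n = (1 / 2 ^ n :: rat)"
      by (simp add: power_one_over flip: power_mult_distrib)
    moreover have "\<tau>_part n l (part_u n) =
        fact n * (of_int s gchoose n) * ((-1) ^ n * (- 1 / 2) ^ n)"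
      unfolding \<tau>_part_u ones_term_def s_def by (simp only: diff_self_eq_0 fact_0 div_by_1 mult_ac)
    ultimately have "\<tau>_part n l (part_u n) = (fact n / 2 ^ n) * (of_int s gchoose n)"
      by simp
    also have "\<dots> = 2 powi (- int (\<sigma>\<^sub>2 n)) * (of_int c * (of_int s gchoose n))"
      unfolding c(2) by simp
    finally show ?thesis
      by (simp only: \<nu>\<^sub>2_powi_mult \<nu>\<^sub>2_odd_mult[OF c(1)] s_def)
  qed
  have u'': "\<nu>\<^sub>2 (\<tau>_part n l (part_u'' n)) =
      Fin (1 - int (\<sigma>\<^sub>2 n)) + \<nu>\<^sub>2 (of_int (l - int n - 1) gchoose (n - 2))" if n: "n \<ge> 3" "odd n"
  proof -
    obtain c :: int where c: "odd c" "(fact n / 2 ^ n :: rat) = 2 powi (- int (\<sigma>\<^sub>2 n)) * of_int c"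
      by (rule fact_div_power_2)
    obtain m where m: "n = Suc (Suc m)" "odd m"
      using n by (metis Suc_le_D even_Suc numeral_3_eq_3 Suc_le_mono)
    have "\<tau>_part n l (part_u'' n) = (fact n / 2 ^ n) * 2 * of_nat m * (of_int s gchoose m)"
    proof -
      \<comment> \<open>With \<open>n = m + 2\<close>, n! / (2! 2^m) is 2 n! / 2^n, which explains
        the summand 1 in the valuation; the odd \<open>m\<close> is a unit.\<close>
      have "n - 2 = m" "n - m = 2" "(2 :: rat) ^ n = 4 * 2 ^ m" "(- 1 / 2) ^ m = (- 1 / 2 ^ m :: rat)"
        using m by (simp_all add: power_divide)
      then show ?thesis
        unfolding \<tau>_part_u''[OF n] ones_term_def s_def[symmetric] by simp
    qed
    also have "\<dots> = 2 powi (- int (\<sigma>\<^sub>2 n)) * 2 powi 1 * (of_int (c * int m) * (of_int s gchoose m))"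
      unfolding c(2) by simp
    also have "\<dots> = 2 powi (1 - int (\<sigma>\<^sub>2 n)) * (of_int (c * int m) * (of_int s gchoose m))"
      by (subst power_int_add[symmetric]) simp_all
    finally have "\<nu>\<^sub>2 (\<tau>_part n l (part_u'' n)) = Fin (1 - int (\<sigma>\<^sub>2 n)) + \<nu>\<^sub>2 (of_int s gchoose m)"
      using \<nu>\<^sub>2_odd_mult[of "c * int m"] c m by (simp only: \<nu>\<^sub>2_powi_mult) simp
    then show ?thesis
      by (simp add: m s_def)
  qed
  \<comment> \<open>Stated for arbitrary \<open>l\<close> and \<open>M\<close>, to be instantiated
    also at \<open>l + 1\<close> and \<open>M'\<close> for (c).\<close>
  have b: "(AMPC n l \<longleftrightarrow> SAMPC n (l - 1)) \<and>
        (AMPC n l \<or> SAMPC n (l - 1) \<longrightarrow>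
          \<nu>\<^sub>2 (bernnum n l) = \<nu>\<^sub>2 (poly (bernpoly n l) 1) \<and>
          \<nu>\<^sub>2 (poly (bernpoly n l) 1) = Fin (- M))"
    if "\<nu>\<^sub>2 (of_int l) \<le> \<nu>\<^sub>2 (of_nat n)" "M = max_pole (bernpoly n l)" for l M
    using AMPC_iff_SAMPC[OF that(1)] SAMPC_iff[OF that(2)] that(2) by (auto simp: AMPC_def)
  have c: "\<nu>\<^sub>2 (of_int (l + 1)) = 0 \<and> \<nu>\<^sub>2 (of_int (l + 1)) \<le> \<nu>\<^sub>2 (of_nat n)"
    if "\<nu>\<^sub>2 (of_int l) > \<nu>\<^sub>2 (of_nat n)"
  proof -
    \<comment> \<open>The valuation of \<open>l\<close> exceeds a nonnegative one, so
      \<open>l\<close> is even and \<open>l + 1\<close> is odd; its valuation 0 then meets the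
      condition of (b).\<close>
    have 0: "Fin 0 \<le> \<nu>\<^sub>2 (of_nat n)"
      by (simp add: le_\<nu>\<^sub>2_iff)
    with that have "\<not> \<nu>\<^sub>2 (of_int l) = Fin 0"
      by auto
    then have "even l"
      using pow2_dvd_1_of_int_iff[of l] by (simp add: \<nu>\<^sub>2_eq_Fin_iff)
    then have "\<nu>\<^sub>2 (of_int (l + 1)) = Fin 0"
      unfolding \<nu>\<^sub>2_eq_Fin_iff using pow2_dvd_1_of_int_iff[of "l + 1"] pow2_dvd_0_of_int[of "l + 1"] by simp
    with 0 show ?thesis
      by (simp add: zero_extended_def)
  qed
  show ?thesis
    using a u u'' b[OF _ M] b[OF _ M', unfolded add_diff_cancel_right'] c by (intro conjI) blast+
qed

end
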